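(* Let $F$ be a field with $\operatorname{Char}(F)\neq 2$ and let $R$ be a simple associative unital $F$-algebra. Let $*$ be an involution on $R$ of the first kind with set of symmetric elements $S$, and assume $S\subsetneq R$. Assume $S$ is not a commutative set. Then the following are equivalent: (a) there exist $x,y\in S$ such that $xy-yx\neq 0$ and for every $s\in S$, $xsy\in S^2$; (b) $S^2=R$.
   Context: $S=\{r\in R: r^*=r\}$. The involution $*$ is of the first kind if $Z(R)\subseteq S$, where $Z(R)$ is the center of $R$. A subset $A\subseteq R$ is a commutative set if $xy=yx$ for all $x,y\in A$. $S^2$ denotes the $F$-subspace of $R$ generated by all products $ab$ with $a,b\in S$. *)

theory Defs
  imports Complex_Main
begin

locale unital_algebra = vector_space scale
  for scale :: "'f::field \<Rightarrow> 'r::ring_1 \<Rightarrow> 'r" (infixr "*s" 75) +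
  assumes scale_mult_left: "(c *s x) * y = c *s (x * y)"
    and scale_mult_right: "x * (c *s y) = c *s (x * y)"

definition two_sided_ideal :: "'r::ring_1 set \<Rightarrow> bool" where
  "two_sided_ideal I \<longleftrightarrow>
     0 \<in> I \<and> (\<forall>x\<in>I. \<forall>y\<in>I. x + y \<in> I) \<and> (\<forall>x\<in>I. \<forall>r. r * x \<in> I \<and> x * r \<in> I)"

(* Nontriviality of the ring is part of the class ring_1. In a unital F-algebra every
   two-sided ring ideal is an F-subspace (c *s x = (c *s 1) * x), so simplicity as a ring
   and simplicity as an F-algebra are the same notion. *)
locale simple_unital_algebra = unital_algebra scale
  for scale :: "'f::field \<Rightarrow> 'r::ring_1 \<Rightarrow> 'r" (infixr "*s" 75) +
  assumes simple: "two_sided_ideal (I :: 'r set) \<Longrightarrow> I = {0} \<or> I = UNIV"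

definition ring_center :: "'r::ring_1 set" where
  "ring_center = {z. \<forall>r. z * r = r * z}"

definition commutative_set :: "'r::ring_1 set \<Rightarrow> bool" where
  "commutative_set A \<longleftrightarrow> (\<forall>x\<in>A. \<forall>y\<in>A. x * y = y * x)"

(* No F-linearity is required. An involution of the first kind fixes F1, which lies in the
   center, so it is automatically F-linear. *)
definition involution :: "('r::ring_1 \<Rightarrow> 'r) \<Rightarrow> bool" where
  "involution star \<longleftrightarrow>
     (\<forall>x y. star (x + y) = star x + star y) \<and>
     (\<forall>x y. star (x * y) = star y * star x) \<and>
     (\<forall>x. star (star x) = x)"

definition symmetric_elements :: "('r::ring_1 \<Rightarrow> 'r) \<Rightarrow> 'r set" where
  "symmetric_elements star = {r. star r = r}"

definition first_kind :: "('r::ring_1 \<Rightarrow> 'r) \<Rightarrow> bool" where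
  "first_kind star \<longleftrightarrow> ring_center \<subseteq> symmetric_elements star"

definition (in unital_algebra) product_span :: "'r set \<Rightarrow> 'r set" where
  "product_span A = span {a * b | a b. a \<in> A \<and> b \<in> A}"

end

theory Submission
  imports Defs
begin

text \<open>
  Write \<open>S\<close> for the symmetric elements, \<open>U = S\<^sup>2\<close> and \<open>[a, b] = a b - b a\<close>. Only the step from
  the local condition \<open>x S y \<subseteq> U\<close> to \<open>U = R\<close> has content.

  First, \<open>U\<close> is a Lie ideal of \<open>R\<close>: up to the factor 2, every element of \<open>R\<close> is symmetric plus skew,
  and a commutator of a skew with a symmetric element is again symmetric. As \<open>U\<close> contains the
  noncommutative set \<open>S\<close>, Herstein's argument on Lie ideals of simple rings gives
  \<open>[R, R] \<subseteq> U\<close> (lemma \<open>commutators_in_noncommutative_lie_ideal\<close>). Modulo \<open>U\<close> the factors of a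
  product may therefore be permuted cyclically, as under a trace.

  Now let \<open>c = [x, y] \<noteq> 0\<close>, a skew element. Cyclic permutation turns \<open>x s y \<in> U\<close> into
  \<open>y x s \<in> U\<close> and then into \<open>s y x \<in> U\<close>. Since \<open>s y x\<close> is the image of \<open>x y s\<close> under the
  involution, their sum is symmetric, so that \<open>x y s \<in> U\<close> as well; thus \<open>c s \<in> U\<close> for symmetric \<open>s\<close>.
  For skew \<open>k\<close>, the element \<open>2 c k = (c k + k c) + [c, k]\<close> is in \<open>S + [R, R] \<subseteq> U\<close>. Hence
  \<open>c R \<subseteq> U\<close>, and cyclic permutation once more puts the ideal generated by \<open>c\<close>, which is \<open>R\<close>,
  inside \<open>U\<close>.
\<close>

section \<open>Lie ideals of simple rings\<close>

definition lie_ideal :: "'r::ring_1 set \<Rightarrow> bool" where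
  "lie_ideal L \<longleftrightarrow>
     0 \<in> L \<and> (\<forall>x\<in>L. \<forall>y\<in>L. x - y \<in> L) \<and> (\<forall>x\<in>L. \<forall>r. x * r - r * x \<in> L)"

lemma lie_ideal_add:
  assumes "lie_ideal L" "x \<in> L" "y \<in> L"
  shows "x + y \<in> L"
proof -
  have "x - (0 - y) \<in> L"
    using assms unfolding lie_ideal_def by blast
  thus ?thesis by simp
qed

text \<open>
  A Lie ideal absorbs \<open>a c b\<close> as soon as it absorbs \<open>c R\<close>, because \<open>a c b\<close> and \<open>c b a\<close> differ
  by the commutator of \<open>c b\<close> with \<open>a\<close>; so it contains the two-sided ideal generated by \<open>c\<close>.
\<close>

lemma lie_ideal_eq_UNIV_if_right_multiples:
  fixes L :: "'r::ring_1 set"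
  assumes simple: "\<And>I :: 'r set. two_sided_ideal I \<Longrightarrow> I = {0} \<or> I = UNIV"
    and L: "lie_ideal L"
    and c: "c \<noteq> 0" "\<And>r. c * r \<in> L"
  shows "L = UNIV"
proof -
  note add = lie_ideal_add[OF L]
  \<comment> \<open>the largest two-sided ideal inside \<open>L\<close>\<close>
  define I where "I = {z. \<forall>a b. a * z * b \<in> L}"
  have "two_sided_ideal I"
    unfolding two_sided_ideal_def
  proof (intro conjI ballI allI)
    show "0 \<in> I"
      using L by (simp add: I_def lie_ideal_def)
    show "z + w \<in> I" if "z \<in> I" "w \<in> I" for z w
      using that by (auto simp: I_def distrib_left distrib_right intro: add)
    show "r * z \<in> I" if "z \<in> I" for z r
      using that by (simp add: I_def flip: mult.assoc)
    show "z * r \<in> I" if "z \<in> I" for z r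
      using that by (simp add: I_def mult.assoc)
  qed
  moreover have "c \<in> I"
  proof -
    have "a * c * b \<in> L" for a b
    proof -
      have "(c * b) * (- a) - (- a) * (c * b) \<in> L"
        using L c(2) unfolding lie_ideal_def by blast
      from add[OF this c(2)[of "b * a"]] show ?thesis
        by (simp add: mult.assoc)
    qed
    thus ?thesis by (simp add: I_def)
  qed
  ultimately have "1 \<in> I"
    using simple c(1) by blast
  hence "a * 1 * 1 \<in> L" for a
    unfolding I_def by blast
  thus ?thesis by auto
qed

text \<open>
  Herstein's argument. The set \<open>T\<close> of all \<open>t\<close> with \<open>[t, R] \<subseteq> U\<close> is a Lie ideal containing \<open>U\<close>, and it
  is also closed under products. Since \<open>[u, v r] = [u, v] r + v [u, r]\<close>, this closure gives
  \<open>[u, v] R \<subseteq> T\<close> for \<open>u, v \<in> U\<close>, so that \<open>T\<close> is the whole ring.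
\<close>

lemma commutators_in_noncommutative_lie_ideal:
  fixes U :: "'r::ring_1 set"
  assumes simple: "\<And>I :: 'r set. two_sided_ideal I \<Longrightarrow> I = {0} \<or> I = UNIV"
    and U: "lie_ideal U" "\<not> commutative_set U"
  shows "a * b - b * a \<in> U"
proof -
  note add = lie_ideal_add[OF U(1)]
  have zero: "0 \<in> U" and diff: "\<And>u v. u \<in> U \<Longrightarrow> v \<in> U \<Longrightarrow> u - v \<in> U"
    and comm: "\<And>u r. u \<in> U \<Longrightarrow> u * r - r * u \<in> U"
    using U(1) by (auto simp: lie_ideal_def)
  define T where "T = {t. \<forall>r. t * r - r * t \<in> U}"
  have TI: "t \<in> T" if "\<And>r. t * r - r * t \<in> U" for t
    using that by (simp add: T_def)
  have TD: "t * r - r * t \<in> U" if "t \<in> T" for t r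
    using that by (simp add: T_def)
  have UT: "U \<subseteq> T"
    using comm by (auto intro: TI)
  have Tdiff: "t - t' \<in> T" if "t \<in> T" "t' \<in> T" for t t'
  proof (rule TI)
    fix r
    show "(t - t') * r - r * (t - t') \<in> U"
      using diff[OF TD[OF that(1), of r] TD[OF that(2), of r]] by (simp add: algebra_simps)
  qed
  have Tmult: "t * t' \<in> T" if "t \<in> T" "t' \<in> T" for t t'
  proof (rule TI)
    fix r
    \<comment> \<open>\<open>[t t', r] = [t, t' r] + [t', r t]\<close>\<close>
    show "t * t' * r - r * (t * t') \<in> U"
      using add[OF TD[OF that(1), of "t' * r"] TD[OF that(2), of "r * t"]]
      by (simp add: algebra_simps)
  qed
  have "lie_ideal T"
    using zero UT TD Tdiff unfolding lie_ideal_def by blast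
  obtain u v where uv: "u \<in> U" "v \<in> U" "u * v - v * u \<noteq> 0"
    using U(2) by (auto simp: commutative_set_def)
  have "(u * v - v * u) * r \<in> T" for r
  proof -
    have "v * (u * r - r * u) \<in> T"
      using uv UT comm by (blast intro: Tmult)
    moreover have "u * (v * r) - (v * r) * u \<in> T"
      using comm[OF uv(1)] UT by blast
    ultimately have "u * (v * r) - (v * r) * u - v * (u * r - r * u) \<in> T"
      by (blast intro: Tdiff)
    thus ?thesis by (simp add: algebra_simps)
  qed
  hence "T = UNIV"
    using lie_ideal_eq_UNIV_if_right_multiples[OF simple \<open>lie_ideal T\<close> uv(3)] by blast
  thus ?thesis using TD by blast
qed

section \<open>The span of products of symmetric elements\<close>

context unital_algebra
begin

text \<open>
  In characteristic other than 2 a subspace can be tested on doubles, which makes the splitting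
  \<open>2 r = (r + r\<^sup>*) + (r - r\<^sup>*)\<close> available without halving inside the ring.
\<close>

lemma subspace_halve:
  assumes "CHAR('f) \<noteq> 2" "subspace U" "x + x \<in> U"
  shows "x \<in> U"
proof -
  have two: "(2 :: 'f) \<noteq> 0"
  proof
    assume "(2 :: 'f) = 0"
    hence "CHAR('f) dvd 2"
      using of_nat_eq_0_iff_char_dvd[where 'a='f, of 2] by simp
    moreover from this have "CHAR('f) \<le> 2" "CHAR('f) \<noteq> 0"
      by (auto intro!: dvd_imp_le Nat.gr0I)
    ultimately have "CHAR('f) = 1"
      using assms(1) by linarith
    thus False
      using of_nat_eq_0_iff_char_dvd[where 'a='f, of 1] by simp
  qed
  have "inverse 2 *s (x + x) \<in> U"
    using assms(2,3) by (rule subspace_scale)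
  also have "x + x = (2 :: 'f) *s x"
    using scale_left_distrib[of 1 1 x] by simp
  finally show ?thesis
    using two by simp
qed

context
  fixes star :: "'r \<Rightarrow> 'r" and S U :: "'r set"
  assumes char: "CHAR('f) \<noteq> 2"
    and star: "involution star"
  defines "S \<equiv> symmetric_elements star"
    and "U \<equiv> product_span S"
begin

lemma star_simps:
  "star (x + y) = star x + star y" "star (x * y) = star y * star x" "star (star x) = x"
  using star by (auto simp: involution_def)

lemma star_diff: "star (x - y) = star x - star y"
  using star_simps(1)[of "x - y" y] by (simp add: eq_diff_eq)

lemma star_one: "star 1 = 1"
  using star_simps(2)[of "star 1" 1] by (simp add: star_simps)

lemma symmetric_iff: "x \<in> S \<longleftrightarrow> star x = x"
  by (simp add: S_def symmetric_elements_def)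

lemma star_zero: "star 0 = 0"
  using star_diff[of 0 0] by simp

lemma star_minus: "star (- x) = - star x"
  using star_diff[of 0 x] by (simp add: star_zero)

lemma product_span_subspace: "subspace U"
  by (simp add: U_def product_span_def)

lemma product_in_span: "a \<in> S \<Longrightarrow> b \<in> S \<Longrightarrow> a * b \<in> U"
  unfolding U_def product_span_def by (rule span_base) blast

lemma symmetric_in_span: "a \<in> S \<Longrightarrow> a \<in> U"
  using product_in_span[of a 1] by (simp add: symmetric_iff star_one)

text \<open>
  It suffices to put \<open>[a b, r]\<close> into \<open>U\<close> for symmetric \<open>a, b\<close>. For skew \<open>r\<close>, the Leibniz rule
  writes it through \<open>[a, r]\<close> and \<open>[b, r]\<close>, which are symmetric. For symmetric \<open>r\<close>, split
  \<open>2 a b = (a b + b a) + [a, b]\<close>: the first part is symmetric, and the commutator of the skew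
  second part with \<open>r\<close> is symmetric.
\<close>

lemma product_span_lie_ideal: "lie_ideal U"
proof -
  note add = subspace_add[OF product_span_subspace]
  note diff = subspace_diff[OF product_span_subspace]
  note halve = subspace_halve[OF char product_span_subspace]
  have skew: "a * b * k - k * (a * b) \<in> U" if "a \<in> S" "b \<in> S" "star k = - k" for a b k
  proof -
    have "a * (b * k - k * b) \<in> U" "(a * k - k * a) * b \<in> U"
      using that by (auto intro!: product_in_span simp: symmetric_iff star_simps star_diff)
    from add[OF this] show ?thesis by (simp add: algebra_simps)
  qed
  have sym: "a * b * s - s * (a * b) \<in> U" if "a \<in> S" "b \<in> S" "s \<in> S" for a b s
  proof -
    let ?p = "a * b + b * a" and ?q = "a * b - b * a"
    have "?p \<in> S" "?q * s - s * ?q \<in> S"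
      using that by (simp_all add: symmetric_iff star_simps star_diff algebra_simps)
    hence "?p * s \<in> U" "s * ?p \<in> U" "?q * s - s * ?q \<in> U"
      using that by (auto intro: product_in_span symmetric_in_span)
    hence "(?p * s - s * ?p) + (?q * s - s * ?q) \<in> U"
      by (blast intro: add diff)
    also have "(?p * s - s * ?p) + (?q * s - s * ?q)
        = (a * b * s - s * (a * b)) + (a * b * s - s * (a * b))"
      by (simp add: algebra_simps)
    finally show ?thesis by (rule halve)
  qed
  have gen: "a * b * r - r * (a * b) \<in> U" if "a \<in> S" "b \<in> S" for a b r
  proof -
    let ?s = "r + star r" and ?k = "r - star r"
    have "(a * b * ?s - ?s * (a * b)) + (a * b * ?k - ?k * (a * b)) \<in> U"
      using that by (intro add sym skew) (auto simp: symmetric_iff star_simps star_diff add.commute)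
    also have "(a * b * ?s - ?s * (a * b)) + (a * b * ?k - ?k * (a * b))
        = (a * b * r - r * (a * b)) + (a * b * r - r * (a * b))"
      by (simp add: algebra_simps)
    finally show ?thesis by (rule halve)
  qed
  have "u * r - r * u \<in> U" if "u \<in> U" for u r
    using that unfolding U_def product_span_def
  proof (induction rule: span_induct_alt)
    case base
    show ?case by (simp add: span_zero)
  next
    case (step c x y)
    have "x * r - r * x \<in> U"
      using step(1) gen by blast
    hence "c *s (x * r - r * x) + (y * r - r * y) \<in> U"
      using step(2) subspace_scale[OF product_span_subspace]
      by (intro add) (auto simp: U_def product_span_def)
    also have "c *s (x * r - r * x) + (y * r - r * y) = (c *s x + y) * r - r * (c *s x + y)"
      by (simp add: algebra_simps scale_mult_left scale_mult_right)
    finally show ?case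
      by (simp add: U_def product_span_def)
  qed
  thus ?thesis
    using diff subspace_0[OF product_span_subspace] by (auto simp: lie_ideal_def)
qed

text \<open>
  By \<open>comm\<close>, membership in \<open>U\<close> is invariant under cyclic permutation of the factors of a product.
  This and the involution turn the hypothesis on \<open>x s y\<close> into one on the multiples of the
  single skew element \<open>[x, y]\<close>, and for a skew multiplier the condition is automatic.
\<close>

lemma commutator_multiples_in_product_span:
  assumes comm: "\<And>a b. a * b - b * a \<in> U"
    and xy: "x \<in> S" "y \<in> S" "\<And>s. s \<in> S \<Longrightarrow> x * s * y \<in> U"
  shows "(x * y - y * x) * r \<in> U"
proof -
  note add = subspace_add[OF product_span_subspace]
  note diff = subspace_diff[OF product_span_subspace]
  note halve = subspace_halve[OF char product_span_subspace]
  let ?c = "x * y - y * x"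
  have cyclic: "b * a \<in> U" if "a * b \<in> U" for a b
    using diff[OF that comm[of a b]] by simp
  have sym: "?c * s \<in> U" if "s \<in> S" for s
  proof -
    have yxs: "y * x * s \<in> U"
      using cyclic[of "x * s" y] xy(3)[OF that] by (simp add: mult.assoc)
    have syx: "s * y * x \<in> U"
      using cyclic[of "y * x" s] yxs by (simp add: mult.assoc)
    \<comment> \<open>\<open>s y x\<close> is the image of \<open>x y s\<close> under the involution, so their sum is symmetric\<close>
    have "x * y * s + s * y * x \<in> U"
      using that xy(1,2)
      by (intro symmetric_in_span) (simp add: symmetric_iff star_simps add.commute mult.assoc)
    from diff[OF diff[OF this syx] yxs] show ?thesis
      by (simp add: left_diff_distrib)
  qed
  have skew: "?c * k \<in> U" if "star k = - k" for k
  proof -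
    have "?c * k + k * ?c \<in> U"
      using that xy(1,2)
      by (intro symmetric_in_span) (simp add: symmetric_iff star_simps star_diff algebra_simps)
    from add[OF this comm[of ?c k]] have "?c * k + ?c * k \<in> U"
      by (simp add: algebra_simps)
    thus ?thesis by (rule halve)
  qed
  have "?c * (r + star r) + ?c * (r - star r) \<in> U"
    by (intro add sym skew) (auto simp: symmetric_iff star_simps star_diff add.commute)
  also have "?c * (r + star r) + ?c * (r - star r) = ?c * r + ?c * r"
    by (simp add: algebra_simps)
  finally show ?thesis by (rule halve)
qed

end

end

section \<open>The equivalence\<close>

theorem theorem2p20:
  fixes scale :: "'f::field \<Rightarrow> 'r::ring_1 \<Rightarrow> 'r"
    and star :: "'r \<Rightarrow> 'r"
  assumes "CHAR('f) \<noteq> 2"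
    and "simple_unital_algebra scale"
    and "involution star"
    and "first_kind star"
    and "symmetric_elements star \<subset> UNIV"
    and "\<not> commutative_set (symmetric_elements star)"
  shows "(\<exists>x\<in>symmetric_elements star. \<exists>y\<in>symmetric_elements star.
            x * y - y * x \<noteq> 0 \<and>
            (\<forall>s\<in>symmetric_elements star.
               x * s * y \<in> unital_algebra.product_span scale (symmetric_elements star)))
         \<longleftrightarrow> unital_algebra.product_span scale (symmetric_elements star) = UNIV"
    (is "?local \<longleftrightarrow> ?U = UNIV")
proof
  interpret simple_unital_algebra scale by fact
  note simple = simple_unital_algebra.simple[OF assms(2)]
  have lie: "lie_ideal ?U"
    using assms(1,3) by (rule product_span_lie_ideal)
  have "symmetric_elements star \<subseteq> ?U"
    using symmetric_in_span[OF assms(1,3)] by blast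
  hence "\<not> commutative_set ?U"
    using assms(6) by (auto simp: commutative_set_def)
  note comm = commutators_in_noncommutative_lie_ideal[OF simple lie this]
  assume ?local
  then obtain x y where xy: "x \<in> symmetric_elements star" "y \<in> symmetric_elements star"
      "x * y - y * x \<noteq> 0" "\<And>s. s \<in> symmetric_elements star \<Longrightarrow> x * s * y \<in> ?U"
    by blast
  show "?U = UNIV"
    using commutator_multiples_in_product_span[OF assms(1,3) comm xy(1,2,4)]
    by (intro lie_ideal_eq_UNIV_if_right_multiples[OF simple lie xy(3)])
next
  assume "?U = UNIV"
  thus ?local
    using assms(6) by (auto simp: commutative_set_def)
qed

end
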